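(* Let $\lambda\in(0,1)$, let $m\ge 3$ be an integer, and let $k_1>k_2>\cdots>k_n\ge 2$ be integers ($n\ge 1$). Let ${\bf a},{\bf b}\in\mathbb{A}_{k_1,\ldots,k_n}$ (with respect to these same $\lambda$ and $m$). If $\#\gamma_\ell({\bf a})=\#\gamma_\ell({\bf b})$ for every $1\le \ell\le n$, then $\dim_H K_{\bf a}=\dim_H K_{\bf b}$, where $\dim_H$ denotes Hausdorff dimension.
   Context: Fix $\lambda\in(0,1)$ and an integer $m\ge 3$. For a vector ${\bf a}=(a_1,\ldots,a_m)\in\mathbb{R}^m$ consider the maps $f_i:\mathbb{R}\to\mathbb{R}$, $f_i(x)=\lambda x+a_i$, $1\le i\le m$. The set $K_{\bf a}$ is the unique nonempty compact subset of $\mathbb{R}$ with $K_{\bf a}=\bigcup_{1\le i\le m}f_i(K_{\bf a})$. For integers $k_1>k_2>\cdots>k_n\ge 2$, $\mathbb{A}_{k_1,\ldots,k_n}$ is the collection of all ${\bf a}=(a_1,\ldots,a_m)\in\mathbb{R}^m$ satisfying: (I) $0=a_1<a_2<\cdots<a_m=1-\lambda$; (II) any three (distinct-index) intervals among $f_i([0,1])$, $1\le i\le m$, have empty common intersection; and whenever $i<j$ and $f_i([0,1])\cap f_j([0,1])\ne\emptyset$, the length $|f_i([0,1])\cap f_j([0,1])|$ belongs to $\{\lambda^{k_1},\ldots,\lambda^{k_n}\}$; (III) either $f_1([0,1])\cap f_j([0,1])=\emptyset$ for all $j>1$, or $f_m([0,1])\cap f_j([0,1])=\emptyset$ for all $j<m$.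 Here $|J|$ denotes the length of an interval $J$. For ${\bf a}\in\mathbb{A}_{k_1,\ldots,k_n}$ and $1\le\ell\le n$, $\gamma_\ell({\bf a})=\{1\le i\le m-1:\ |f_i([0,1])\cap f_{i+1}([0,1])|=\lambda^{k_\ell}\}$. $\#S$ denotes the number of elements of a finite set $S$. *)

theory Defs
  imports "HOL-Analysis.Analysis"
begin

section \<open>Hausdorff dimension\<close>

text \<open>The contribution of one covering set to the \<open>s\<close>-dimensional Hausdorff premeasure.
  The case distinction implements the conventions \<open>(diam {})^s = 0\<close> and
  \<open>(diam U)^0 = 1\<close> for nonempty \<open>U\<close>; note that \<open>0 powr 0 = 0\<close> in the library.\<close>

definition hausdorff_weight :: "real \<Rightarrow> 'a::metric_space set \<Rightarrow> ennreal" where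
  "hausdorff_weight s U =
     (if U = {} then 0 else if s = 0 then 1 else ennreal (diameter U powr s))"

text \<open>Covering sets are required to be bounded because \<^const>\<open>diameter\<close> is only meaningful
  for bounded sets. Finite covers are included, since covering sets may be empty.\<close>

definition hausdorff_covers :: "real \<Rightarrow> 'a::metric_space set \<Rightarrow> (nat \<Rightarrow> 'a set) set" where
  "hausdorff_covers \<delta> A =
     {U. A \<subseteq> (\<Union>i. U i) \<and> (\<forall>i. bounded (U i) \<and> diameter (U i) \<le> \<delta>)}"

definition hausdorff_premeasure :: "real \<Rightarrow> real \<Rightarrow> 'a::metric_space set \<Rightarrow> ennreal" where
  "hausdorff_premeasure \<delta> s A =
     (INF U\<in>hausdorff_covers \<delta> A. \<Sum>i. hausdorff_weight s (U i))"

definition hausdorff_measure :: "real \<Rightarrow> 'a::metric_space set \<Rightarrow> ennreal" where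
  "hausdorff_measure s A = (SUP \<delta>\<in>{0<..}. hausdorff_premeasure \<delta> s A)"

definition hausdorff_dim :: "'a::metric_space set \<Rightarrow> ennreal" where
  "hausdorff_dim A = (INF s\<in>{s. 0 \<le> s \<and> hausdorff_measure s A = 0}. ennreal s)"

section \<open>Self-similar sets on the line\<close>

text \<open>A vector of \<open>\<real>^m\<close> is represented by a function \<open>a :: nat \<Rightarrow> real\<close> of which only the
  values at the indices \<open>1, \<dots>, m\<close> matter; likewise the sequence \<open>k\<close> of exponents below is
  only used at the indices \<open>1, \<dots>, n\<close>. The common contraction ratio is written \<open>\<rho>\<close>.\<close>

definition ifs_map :: "real \<Rightarrow> (nat \<Rightarrow> real) \<Rightarrow> nat \<Rightarrow> real \<Rightarrow> real" where
  "ifs_map \<rho> a i x = \<rho> * x + a i"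

definition self_similar_set :: "real \<Rightarrow> nat \<Rightarrow> (nat \<Rightarrow> real) \<Rightarrow> real set" where
  "self_similar_set \<rho> m a =
     (THE K. K \<noteq> {} \<and> compact K \<and> K = (\<Union>i\<in>{1..m}. ifs_map \<rho> a i ` K))"

definition ifs_interval :: "real \<Rightarrow> (nat \<Rightarrow> real) \<Rightarrow> nat \<Rightarrow> real set" where
  "ifs_interval \<rho> a i = ifs_map \<rho> a i ` {0..1}"

text \<open>The class of translation vectors with overlaps of lengths \<open>\<rho>^(k 1), \<dots>, \<rho>^(k n)\<close>. The length
  of an interval is its Lebesgue measure.\<close>

definition overlap_class :: "real \<Rightarrow> nat \<Rightarrow> nat \<Rightarrow> (nat \<Rightarrow> nat) \<Rightarrow> (nat \<Rightarrow> real) set" where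
  "overlap_class \<rho> m n k = {a.
     a 1 = 0 \<and> (\<forall>i\<in>{1..<m}. a i < a (Suc i)) \<and> a m = 1 - \<rho> \<and>
     (\<forall>h\<in>{1..m}. \<forall>i\<in>{1..m}. \<forall>j\<in>{1..m}. h \<noteq> i \<and> h \<noteq> j \<and> i \<noteq> j \<longrightarrow>
        ifs_interval \<rho> a h \<inter> ifs_interval \<rho> a i \<inter> ifs_interval \<rho> a j = {}) \<and>
     (\<forall>i\<in>{1..m}. \<forall>j\<in>{1..m}. i < j \<and> ifs_interval \<rho> a i \<inter> ifs_interval \<rho> a j \<noteq> {} \<longrightarrow>
        measure lborel (ifs_interval \<rho> a i \<inter> ifs_interval \<rho> a j) \<in> {\<rho> ^ k l | l. l \<in> {1..n}}) \<and>
     ((\<forall>j\<in>{1<..m}. ifs_interval \<rho> a 1 \<inter> ifs_interval \<rho> a j = {}) \<or>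
      (\<forall>j\<in>{1..<m}. ifs_interval \<rho> a m \<inter> ifs_interval \<rho> a j = {}))}"

definition overlap_indices ::
    "real \<Rightarrow> nat \<Rightarrow> (nat \<Rightarrow> nat) \<Rightarrow> (nat \<Rightarrow> real) \<Rightarrow> nat \<Rightarrow> nat set" where
  "overlap_indices \<rho> m k a l =
     {i\<in>{1..m - 1}. measure lborel (ifs_interval \<rho> a i \<inter> ifs_interval \<rho> a (Suc i)) = \<rho> ^ k l}"

end

theory Submission
  imports Defs
begin

text \<open>All maps composed of \<open>p\<close> generators have the ratio \<open>\<rho>^p\<close>, so such a map is determined by
  its value at \<open>0\<close>, the origin of a cell \<open>[t, t + \<rho>^p]\<close>. Let \<open>N p\<close> be the number of \<^emph>\<open>distinct\<close>
  origins of level \<open>p\<close>. The dimension of the attractor is a function of the sequence \<open>N\<close>, and \<open>N\<close>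
  obeys a linear recursion in which the vector of translations enters only through the numbers of
  overlaps of each length. Hence equal overlap numbers give equal dimensions.

  \<^bold>\<open>The recursion.\<close> If two neighbouring first-level intervals overlap in length \<open>\<rho>^K\<close>, then the
  overlap is itself a cell of level \<open>K\<close> of both: the last cell of level \<open>K - 1\<close> inside the left
  interval and the first one inside the right interval are the same affine image. Since one of the
  two outermost first-level intervals is isolated, every cell that lies in the overlap comes from
  this common cell, on at least one of the two sides, and therefore on both. So the cells of level
  \<open>p + 1\<close> counted twice in \<open>m * N p\<close> are, for each overlap of length \<open>\<rho>^K\<close>, exactly
  \<open>N (p + 1 - K)\<close> many (none if \<open>K > p + 1\<close>), and intervals that are not neighbours share no cell.
  This is \<open>card_D_recursion\<close>; induction on the level gives \<open>card_cell_origins_eq\<close>.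

  \<^bold>\<open>The dimension.\<close> The same rigidity shows that the difference of two cells of equal level that
  meet, measured in units of their length, takes only finitely many values (\<open>ex_window_bound\<close>). So
  an interval of length \<open>\<rho>^p\<close> contains at most \<open>C\<close> origins of level \<open>p\<close>, with \<open>C\<close> independent of
  \<open>p\<close>. Counting then replaces the usual mass distribution: \<open>N p * N q \<le> C * N (p + q)\<close>, and a
  ball of radius about \<open>\<rho>^q\<close> contains at most \<open>4 * C * N (P - q)\<close>, thus at most
  \<open>4 * C^2 * N P / N q\<close>, of the \<open>N P\<close> origins of a deep level \<open>P\<close>. Since all origins lie in the attractor, a
  cover of it by balls must have a total weight bounded below in terms of \<open>inf N p * \<rho>^(p s)\<close>.
  Consequently the \<open>s\<close>-dimensional measure of the attractor vanishes if and only if this infimum is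
  zero (\<open>measure_attractor_eq_0_iff\<close>), a criterion that sees nothing but \<open>N\<close>.\<close>

section \<open>Enlarging a covering set\<close>

text \<open>Passing from a set of diameter \<open>d\<close> to an open ball of radius \<open>r > d\<close> about one of its points
  costs arbitrarily little weight. The case distinction agrees with that of
  \<^const>\<open>hausdorff_weight\<close> on nonempty sets.\<close>

lemma ex_slightly_larger_radius:
  fixes d s e :: real
  assumes "0 \<le> d" "d < 1" "0 \<le> s" "0 < e"
  obtains r where "d < r" "r < 1" "r powr s \<le> (if s = 0 then 1 else d powr s) + e"
proof (cases "s = 0")
  case True
  obtain r where "d < r" "r < 1" using dense[OF assms(2)] by blast
  then show ?thesis using that True assms by simp
next
  case False
  define y where "y = d powr s + e"
  have "d = (d powr s) powr (1 / s)" using assms False by (simp add: powr_powr)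
  also have "\<dots> < y powr (1 / s)" using assms False by (intro powr_less_mono2) (auto simp: y_def)
  finally have "d < min 1 (y powr (1 / s))" using assms by simp
  then obtain r where r: "d < r" "r < min 1 (y powr (1 / s))" using dense by blast
  have "r powr s \<le> (y powr (1 / s)) powr s" using r assms by (intro powr_mono2) auto
  also have "\<dots> = y" using assms False by (simp add: powr_powr y_def add_nonneg_pos)
  finally show ?thesis using that r False by (simp add: y_def)
qed

section \<open>Cells of an affine system on the line\<close>

text \<open>The values at \<open>0\<close> of all compositions of \<open>p\<close> maps. As a set of reals it identifies words that
  give the same composition, so that its cardinality is the number of distinct cells.\<close>

primrec cell_origins :: "real \<Rightarrow> nat \<Rightarrow> (nat \<Rightarrow> real) \<Rightarrow> nat \<Rightarrow> real set" where
  "cell_origins \<rho> m a 0 = {0}"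
| "cell_origins \<rho> m a (Suc p) = (\<Union>i\<in>{1..m}. ifs_map \<rho> a i ` cell_origins \<rho> m a p)"

locale line_ifs =
  fixes \<rho> :: real and m :: nat and a :: "nat \<Rightarrow> real"
  assumes ratio_pos: "0 < \<rho>" and ratio_less_1: "\<rho> < 1"
    and maps_nonempty: "1 \<le> m"
    and first_map: "a 1 = 0" and last_map: "a m = 1 - \<rho>"
    and translation_bounds: "i \<in> {1..m} \<Longrightarrow> 0 \<le> a i \<and> a i \<le> 1 - \<rho>"
begin

abbreviation D :: "nat \<Rightarrow> real set" where "D \<equiv> cell_origins \<rho> m a"

lemma finite_D: "finite (D p)"
  by (induction p) auto

lemma D_SucI: "i \<in> {1..m} \<Longrightarrow> t \<in> D p \<Longrightarrow> \<rho> * t + a i \<in> D (Suc p)"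
  by (auto simp: ifs_map_def)

lemma D_SucE:
  assumes "x \<in> D (Suc p)"
  obtains i t where "i \<in> {1..m}" "t \<in> D p" "x = \<rho> * t + a i"
  using assms by (auto simp: ifs_map_def)

lemma zero_in_D: "0 \<in> D p"
proof (induction p)
  case (Suc p)
  then show ?case using D_SucI[of 1 0 p] maps_nonempty first_map by simp
qed simp

lemma card_D_pos: "0 < card (D p)"
  using finite_D zero_in_D card_gt_0_iff by blast

lemma last_in_D: "1 - \<rho> ^ p \<in> D p"
proof (induction p)
  case (Suc p)
  have "\<rho> * (1 - \<rho> ^ p) + a m \<in> D (Suc p)"
    by (rule D_SucI[OF _ Suc]) (use maps_nonempty in auto)
  then show ?case by (simp add: last_map algebra_simps del: cell_origins.simps)
qed simp

lemma D_bounds: "t \<in> D p \<Longrightarrow> 0 \<le> t \<and> t + \<rho> ^ p \<le> 1"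
proof (induction p arbitrary: t)
  case (Suc p)
  from Suc.prems obtain i u where iu: "i \<in> {1..m}" "u \<in> D p" "t = \<rho> * u + a i"
    by (rule D_SucE)
  have "\<rho> * (u + \<rho> ^ p) \<le> \<rho> * 1"
    using Suc.IH[OF iu(2)] ratio_pos by (intro mult_left_mono) auto
  then show ?case
    using Suc.IH[OF iu(2)] translation_bounds[OF iu(1)] iu(3) ratio_pos
    by (simp add: algebra_simps)
qed simp

lemma D_compose: "t \<in> D p \<Longrightarrow> u \<in> D q \<Longrightarrow> t + \<rho> ^ p * u \<in> D (p + q)"
proof (induction p arbitrary: t)
  case (Suc p)
  from Suc.prems obtain i v where iv: "i \<in> {1..m}" "v \<in> D p" "t = \<rho> * v + a i"
    by (blast elim: D_SucE)
  have "\<rho> * (v + \<rho> ^ p * u) + a i \<in> D (Suc (p + q))"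
    using iv Suc by (intro D_SucI) auto
  then show ?case using iv(3) by (simp add: algebra_simps del: cell_origins.simps)
qed simp

text \<open>Together with the previous lemma this says that a cell of level \<open>p + q\<close> is a cell of level \<open>q\<close>
  placed inside a cell of level \<open>p\<close>.\<close>

lemma D_decompose:
  "x \<in> D (p + q) \<Longrightarrow> \<exists>t\<in>D p. \<exists>u\<in>D q. x = t + \<rho> ^ p * u"
proof (induction p arbitrary: x)
  case (Suc p)
  then have "x \<in> D (Suc (p + q))" by simp
  then obtain i v where iv: "i \<in> {1..m}" "v \<in> D (p + q)" "x = \<rho> * v + a i"
    by (rule D_SucE)
  from Suc.IH[OF iv(2)] obtain t u where tu: "t \<in> D p" "u \<in> D q" "v = t + \<rho> ^ p * u" by blast
  have "\<rho> * t + a i \<in> D (Suc p)" using iv(1) tu(1) by (rule D_SucI)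
  moreover have "x = (\<rho> * t + a i) + \<rho> ^ Suc p * u"
    using iv(3) tu(3) by (simp add: algebra_simps)
  ultimately show ?case using tu(2) by blast
qed simp

section \<open>The attractor\<close>

definition cells :: "nat \<Rightarrow> real set" where
  "cells p = (\<Union>t\<in>D p. {t..t + \<rho> ^ p})"

lemma cells_0: "cells 0 = {0..1}"
  by (simp add: cells_def)

lemma cells_Suc: "cells (Suc p) = (\<Union>i\<in>{1..m}. ifs_map \<rho> a i ` cells p)"
proof -
  have "ifs_map \<rho> a i ` {t..t + \<rho> ^ p} = {ifs_map \<rho> a i t..ifs_map \<rho> a i t + \<rho> ^ Suc p}"
    for i t
    using image_affinity_atLeastAtMost[of \<rho> "a i" t "t + \<rho> ^ p"] ratio_pos
    by (simp add: ifs_map_def[abs_def] algebra_simps)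
  then have "ifs_map \<rho> a i ` cells p
    = (\<Union>t\<in>D p. {ifs_map \<rho> a i t..ifs_map \<rho> a i t + \<rho> ^ Suc p})" for i
    unfolding cells_def image_UN by simp
  then show ?thesis by (simp add: cells_def)
qed

lemma cells_Suc_subset: "cells (Suc p) \<subseteq> cells p"
proof (induction p)
  case 0
  have "t \<in> D (Suc 0) \<Longrightarrow> {t..t + \<rho> ^ Suc 0} \<subseteq> {0..1}" for t
    using D_bounds[of t "Suc 0"] by (auto simp del: cell_origins.simps)
  then show ?case unfolding cells_0 unfolding cells_def by blast
next
  case (Suc p)
  then show ?case unfolding cells_Suc[of "Suc p"] cells_Suc[of p] by blast
qed

lemma cells_antimono: "p \<le> q \<Longrightarrow> cells q \<subseteq> cells p"
  by (rule lift_Suc_antimono_le[of cells]) (rule cells_Suc_subset)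

lemma compact_cells: "compact (cells p)"
  unfolding cells_def by (intro compact_UN finite_D compact_Icc)

definition attractor :: "real set" where
  "attractor = (\<Inter>p. cells p)"

lemma compact_attractor: "compact attractor"
  unfolding attractor_def by (rule compact_Inter) (auto simp: compact_cells)

lemma D_subset_cells: "D p \<subseteq> cells q"
proof (cases "p \<le> q")
  case True
  have "t \<in> cells q" if "t \<in> D p" for t
  proof -
    have "t + \<rho> ^ p * 0 \<in> D (p + (q - p))"
      using that zero_in_D by (rule D_compose)
    then show ?thesis using True ratio_pos by (force simp: cells_def)
  qed
  then show ?thesis by blast
next
  case False
  have "D p \<subseteq> cells p" using ratio_pos by (force simp: cells_def)
  then show ?thesis using cells_antimono[of q p] False by auto
qed

lemma D_subset_attractor: "D p \<subseteq> attractor"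
  using D_subset_cells by (auto simp: attractor_def)

text \<open>The inclusion from left to right is a pigeonhole argument: a point that lies in the image of the
  level-\<open>p\<close> cells under some generator for every \<open>p\<close> does so under one fixed generator for
  infinitely many \<open>p\<close>, and hence for all \<open>p\<close> because the sets decrease.\<close>

lemma attractor_invariant: "attractor = (\<Union>i\<in>{1..m}. ifs_map \<rho> a i ` attractor)"
proof (rule set_eqI, rule iffI)
  fix x assume "x \<in> attractor"
  then have "x \<in> cells (Suc p)" for p by (simp add: attractor_def)
  then have "\<forall>p. \<exists>i\<in>{1..m}. x \<in> ifs_map \<rho> a i ` cells p" unfolding cells_Suc by blast
  then obtain f where f: "\<And>p. f p \<in> {1..m}" "\<And>p. x \<in> ifs_map \<rho> a (f p) ` cells p"
    by metis
  have "finite (range f)" using f(1) by (meson finite_atLeastAtMost finite_subset image_subsetI)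
  then obtain p0 where inf: "infinite {p. f p = f p0}"
    using pigeonhole_infinite[of "UNIV::nat set" f] by auto
  define y where "y = (x - a (f p0)) / \<rho>"
  have x: "x = ifs_map \<rho> a (f p0) y" using ratio_pos by (simp add: y_def ifs_map_def)
  have "y \<in> cells q" for q
  proof -
    obtain p where p: "q \<le> p" "f p = f p0"
      using inf unfolding infinite_nat_iff_unbounded_le by blast
    obtain z where "z \<in> cells p" "x = ifs_map \<rho> a (f p0) z" using f(2)[of p] p(2) by auto
    then have "y \<in> cells p" using x ratio_pos by (simp add: ifs_map_def)
    then show ?thesis using cells_antimono[OF p(1)] by blast
  qed
  then have "y \<in> attractor" by (simp add: attractor_def)
  then show "x \<in> (\<Union>i\<in>{1..m}. ifs_map \<rho> a i ` attractor)"
    using x f(1)[of p0] by blast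
next
  fix x assume "x \<in> (\<Union>i\<in>{1..m}. ifs_map \<rho> a i ` attractor)"
  then have "x \<in> cells (Suc p)" for p by (auto simp: attractor_def cells_Suc)
  then show "x \<in> attractor" using cells_Suc_subset by (auto simp: attractor_def)
qed

text \<open>An invariant compact set lies in \<open>[0, 1]\<close> because its extreme points do, and so in all levels of
  cells. Conversely it has a point in every cell, hence comes arbitrarily close to each point of the
  attractor, and it is closed.\<close>

lemma invariant_compact_unique:
  assumes ne: "K \<noteq> {}" and K: "compact K" and inv: "K = (\<Union>i\<in>{1..m}. ifs_map \<rho> a i ` K)"
  shows "K = attractor"
proof
  have inv_sub: "x \<in> K \<Longrightarrow> \<exists>i\<in>{1..m}. \<exists>y\<in>K. x = \<rho> * y + a i" for x
    using subsetD[OF equalityD1[OF inv]] unfolding ifs_map_def by blast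
  have "K \<subseteq> {0..1}"
  proof -
    obtain M where M: "M \<in> K" "\<And>x. x \<in> K \<Longrightarrow> x \<le> M" using compact_attains_sup[OF K ne] by blast
    obtain L where L: "L \<in> K" "\<And>x. x \<in> K \<Longrightarrow> L \<le> x" using compact_attains_inf[OF K ne] by blast
    obtain i x where i: "i \<in> {1..m}" "x \<in> K" "M = \<rho> * x + a i"
      using inv_sub[OF M(1)] by blast
    have "\<rho> * x \<le> \<rho> * M" using M(2)[OF i(2)] ratio_pos by simp
    then have "(1 - \<rho>) * M \<le> (1 - \<rho>) * 1"
      using i(3) translation_bounds[OF i(1)] by (simp add: algebra_simps)
    then have "M \<le> 1" using ratio_less_1 by (simp only: mult_le_cancel_left_pos)
    obtain j y where j: "j \<in> {1..m}" "y \<in> K" "L = \<rho> * y + a j"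
      using inv_sub[OF L(1)] by blast
    have "\<rho> * L \<le> \<rho> * y" using L(2)[OF j(2)] ratio_pos by simp
    then have "(1 - \<rho>) * 0 \<le> (1 - \<rho>) * L"
      using j(3) translation_bounds[OF j(1)] by (simp add: algebra_simps)
    then have "0 \<le> L" using ratio_less_1 by (simp only: mult_le_cancel_left_pos)
    then show ?thesis using M L \<open>M \<le> 1\<close> by force
  qed
  then have "K \<subseteq> cells p" for p
  proof (induction p)
    case (Suc p)
    show ?case
    proof
      fix x assume "x \<in> K"
      then obtain i y where "i \<in> {1..m}" "y \<in> K" "x = ifs_map \<rho> a i y"
        using inv_sub unfolding ifs_map_def by blast
      then show "x \<in> cells (Suc p)" using Suc unfolding cells_Suc by blast
    qed
  qed (simp add: cells_0)
  then show "K \<subseteq> attractor" by (auto simp: attractor_def)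
next
  have sub: "y \<in> K \<Longrightarrow> t \<in> D p \<Longrightarrow> t + \<rho> ^ p * y \<in> K" for y t p
  proof (induction p arbitrary: t)
    case (Suc p)
    from Suc.prems(2) obtain i v where iv: "i \<in> {1..m}" "v \<in> D p" "t = \<rho> * v + a i"
      by (rule D_SucE)
    have "ifs_map \<rho> a i (v + \<rho> ^ p * y) \<in> K"
      using Suc.IH[OF Suc.prems(1) iv(2)] iv(1) equalityD2[OF inv] by blast
    then show ?case using iv by (simp add: ifs_map_def algebra_simps)
  qed simp
  show "attractor \<subseteq> K"
  proof
    fix x assume x: "x \<in> attractor"
    obtain y where y: "y \<in> K" using ne by blast
    have "\<forall>e>0. \<exists>z\<in>K. dist z x < e"
    proof (intro allI impI)
      fix e :: real assume "0 < e"
      then obtain p where p: "\<rho> ^ p < e / (1 + \<bar>y\<bar>)"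
        using real_arch_pow_inv[of "e / (1 + \<bar>y\<bar>)" \<rho>] ratio_less_1 by auto
      obtain t where t: "t \<in> D p" "t \<le> x" "x \<le> t + \<rho> ^ p"
        using x by (auto simp: attractor_def cells_def)
      have "\<bar>t + \<rho> ^ p * y - x\<bar> \<le> \<bar>t - x\<bar> + \<bar>\<rho> ^ p * y\<bar>" by linarith
      also have "\<dots> \<le> \<rho> ^ p * (1 + \<bar>y\<bar>)"
        using t ratio_pos by (simp add: abs_mult algebra_simps)
      also have "\<dots> < e" using p by (simp add: pos_less_divide_eq)
      finally show "\<exists>z\<in>K. dist z x < e" using sub[OF y t(1)] by (auto simp: dist_real_def)
    qed
    then show "x \<in> K"
      using closure_approachable[of x K] compact_imp_closed[OF K] by simp
  qed
qed

text \<open>Existence and uniqueness of the invariant set turn the definite description into the explicit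
  intersection of the levels.\<close>

lemma self_similar_set_eq: "self_similar_set \<rho> m a = attractor"
  unfolding self_similar_set_def
proof (rule the_equality)
  show "attractor \<noteq> {} \<and> compact attractor \<and> attractor = (\<Union>i\<in>{1..m}. ifs_map \<rho> a i ` attractor)"
    using D_subset_attractor[of 0] compact_attractor attractor_invariant by auto
qed (use invariant_compact_unique in blast)


section \<open>Null sets of the Hausdorff measure and the number of cells\<close>

lemma premeasure_attractor_le:
  assumes "0 \<le> s" and p: "\<rho> ^ p \<le> \<delta>"
  shows "hausdorff_premeasure \<delta> s attractor \<le> ennreal (card (D p) * (\<rho> ^ p) powr s)"
proof -
  define N where "N = card (D p)"
  obtain h where h: "bij_betw h {0..<N} (D p)"
    using ex_bij_betw_nat_finite[OF finite_D] unfolding N_def by blast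
  define U where "U i = (if i < N then {h i..h i + \<rho> ^ p} else {})" for i
  have pos: "0 < \<rho> ^ p" using ratio_pos by simp
  have "cells p \<subseteq> (\<Union>i. U i)"
  proof
    fix x assume "x \<in> cells p"
    then obtain t where t: "t \<in> D p" "x \<in> {t..t + \<rho> ^ p}" by (auto simp: cells_def)
    then obtain i where "i < N" "h i = t" using h by (force simp: bij_betw_def)
    then have "x \<in> U i" using t by (simp add: U_def)
    then show "x \<in> (\<Union>i. U i)" by blast
  qed
  then have "attractor \<subseteq> (\<Union>i. U i)" unfolding attractor_def by blast
  moreover have "bounded (U i) \<and> diameter (U i) \<le> \<delta>" for i
    using p pos by (simp add: U_def)
  ultimately have "U \<in> hausdorff_covers \<delta> attractor" by (simp add: hausdorff_covers_def)
  then have "hausdorff_premeasure \<delta> s attractor \<le> (\<Sum>i. hausdorff_weight s (U i))"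
    unfolding hausdorff_premeasure_def by (rule INF_lower)
  also have "\<dots> = (\<Sum>i\<in>{..<N}. hausdorff_weight s (U i))"
    by (rule suminf_finite) (auto simp: U_def hausdorff_weight_def)
  also have "\<dots> = (\<Sum>i\<in>{..<N}. ennreal ((\<rho> ^ p) powr s))"
    using pos ratio_pos by (intro sum.cong) (auto simp: U_def hausdorff_weight_def)
  also have "\<dots> = ennreal (card (D p) * (\<rho> ^ p) powr s)"
    by (simp add: N_def ennreal_mult ennreal_of_nat_eq_real_of_nat)
  finally show ?thesis .
qed

text \<open>The cells of one level form a cover of weight \<open>card (D p) * (\<rho> ^ p) powr s\<close>. Since this number is
  positive for every \<open>p\<close>, values arbitrarily close to zero occur at arbitrarily deep levels, whose
  cells are as short as a given \<open>\<delta>\<close> demands.\<close>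

lemma measure_attractor_eq_0:
  assumes s: "0 \<le> s" and small: "\<And>e. 0 < e \<Longrightarrow> \<exists>p. card (D p) * (\<rho> ^ p) powr s < e"
  shows "hausdorff_measure s attractor = 0"
proof -
  define M where "M p = card (D p) * (\<rho> ^ p) powr s" for p
  have Mpos: "0 < M p" for p using card_D_pos ratio_pos by (simp add: M_def)
  have "hausdorff_premeasure \<delta> s attractor \<le> 0" if "0 < \<delta>" for \<delta>
  proof (rule ennreal_le_epsilon)
    fix e :: real assume "0 < e"
    obtain p0 where p0: "\<rho> ^ p0 < \<delta>"
      using real_arch_pow_inv[OF \<open>0 < \<delta>\<close> ratio_less_1] by blast
    \<comment> \<open>A value below this minimum can only occur at a level deeper than \<open>p0\<close>.\<close>
    define e' where "e' = Min (insert e (M ` {..p0}))"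
    have "0 < e'" using Mpos \<open>0 < e\<close> by (simp add: e'_def)
    then obtain p where p: "M p < e'" using small unfolding M_def by blast
    have "e' \<le> e" by (simp add: e'_def)
    have "p0 < p"
    proof (rule ccontr)
      assume "\<not> p0 < p"
      then have "e' \<le> M p" unfolding e'_def by (intro Min_le) auto
      then show False using p by simp
    qed
    then have "\<rho> ^ p \<le> \<delta>"
      using power_decreasing[of p0 p \<rho>] ratio_pos ratio_less_1 p0 by linarith
    then have "hausdorff_premeasure \<delta> s attractor \<le> ennreal (M p)"
      unfolding M_def by (rule premeasure_attractor_le[OF s])
    also have "\<dots> \<le> ennreal e" using p \<open>e' \<le> e\<close> by (intro ennreal_leI) simp
    finally show "hausdorff_premeasure \<delta> s attractor \<le> 0 + ennreal e" by simp
  qed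
  then show ?thesis unfolding hausdorff_measure_def
    by (metis (no_types, lifting) SUP_least greaterThan_iff le_zero_eq)
qed

lemma ex_power_scale:
  assumes "0 < r" "r < 1"
  obtains q where "\<rho> ^ Suc q \<le> r" "r < \<rho> ^ q"
proof -
  obtain p where "\<rho> ^ p < r" using real_arch_pow_inv[OF assms(1) ratio_less_1] by blast
  define P where "P = (LEAST p. \<rho> ^ p \<le> r)"
  have P: "\<rho> ^ P \<le> r" unfolding P_def using \<open>\<rho> ^ p < r\<close>
    by (intro LeastI[of "\<lambda>p. \<rho> ^ p \<le> r" p] less_imp_le)
  then obtain q where q: "P = Suc q" using assms(2) by (cases P) auto
  have "\<not> \<rho> ^ q \<le> r" using not_less_Least[of q "\<lambda>p. \<rho> ^ p \<le> r"] q P_def by simp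
  then show ?thesis using that P q by simp
qed

context
  fixes C :: nat
  assumes window: "card {t \<in> D p. y \<le> t \<and> t \<le> y + \<rho> ^ p} \<le> C"
begin

text \<open>Placing a level-\<open>q\<close> cell inside a level-\<open>p\<close> cell gives every cell of level \<open>p + q\<close>, and each of
  them at most \<open>C\<close> times: the outer origin lies within \<open>\<rho> ^ p\<close> to the left of the inner one and
  determines the level-\<open>q\<close> part.\<close>

lemma card_D_supermultiplicative: "card (D p) * card (D q) \<le> C * card (D (p + q))"
proof -
  define f where "f z = fst z + \<rho> ^ p * snd z" for z :: "real \<times> real"
  let ?S = "D p \<times> D q"
  have "f ` ?S \<subseteq> D (p + q)" using D_compose by (auto simp: f_def)
  have fibre: "card {z \<in> ?S. f z = x} \<le> C" for x
  proof -
    let ?W = "{t \<in> D p. x - \<rho> ^ p \<le> t \<and> t \<le> x - \<rho> ^ p + \<rho> ^ p}"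
    have inj: "inj_on fst {z \<in> ?S. f z = x}"
      using ratio_pos by (auto simp: inj_on_def f_def)
    have "0 \<le> \<rho> ^ p * u \<and> \<rho> ^ p * u \<le> \<rho> ^ p" if "u \<in> D q" for u
    proof -
      have "0 \<le> u" "u \<le> 1" using D_bounds[OF that] ratio_pos
        by (auto intro: order_trans[of _ "u + \<rho> ^ q"])
      then show ?thesis using ratio_pos by (simp add: mult_left_le)
    qed
    then have "fst ` {z \<in> ?S. f z = x} \<subseteq> ?W" by (force simp: f_def)
    then have "card (fst ` {z \<in> ?S. f z = x}) \<le> card ?W"
      by (intro card_mono) (simp_all add: finite_D)
    then show ?thesis using window[where p=p and y="x - \<rho> ^ p"] card_image[OF inj] by simp
  qed
  have "card ?S = (\<Sum>x\<in>f ` ?S. card {z \<in> ?S. f z = x})"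
    using sum.image_gen[of ?S "\<lambda>_. 1::nat" f] finite_D by simp
  also have "\<dots> \<le> (\<Sum>x\<in>f ` ?S. C)" by (rule sum_mono) (rule fibre)
  also have "\<dots> \<le> C * card (D (p + q))"
    using card_mono[OF finite_D \<open>f ` ?S \<subseteq> D (p + q)\<close>] by simp
  finally show ?thesis by (simp add: card_cartesian_product)
qed

text \<open>The level-\<open>q\<close> cells whose descendants can meet the ball have their origins in an interval of
  length \<open>4 * \<rho> ^ q\<close>, which four windows cover.\<close>

lemma card_D_ball_le:
  assumes r: "r \<le> \<rho> ^ q"
  shows "card (D (q + p) \<inter> ball x r) \<le> 4 * C * card (D p)"
proof -
  define W where "W y = {t \<in> D q. y \<le> t \<and> t \<le> y + \<rho> ^ q}" for y
  define B where "B = W (x - 2 * \<rho> ^ q) \<union> W (x - \<rho> ^ q) \<union> W x \<union> W (x + \<rho> ^ q)"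
  have finB: "finite B" by (simp add: B_def W_def finite_D)
  have "card B \<le> card (W (x - 2 * \<rho> ^ q)) + card (W (x - \<rho> ^ q)) + card (W x) + card (W (x + \<rho> ^ q))"
    unfolding B_def by (meson add_le_mono1 card_Un_le order_trans)
  also have "\<dots> \<le> 4 * C"
    using window[where p=q and y="x - 2 * \<rho> ^ q"] window[where p=q and y="x - \<rho> ^ q"]
      window[where p=q and y=x] window[where p=q and y="x + \<rho> ^ q"]
    unfolding W_def by linarith
  finally have cardB: "card B \<le> 4 * C" .
  have "D (q + p) \<inter> ball x r \<subseteq> (\<lambda>(t, u). t + \<rho> ^ q * u) ` (B \<times> D p)"
  proof
    fix z assume z: "z \<in> D (q + p) \<inter> ball x r"
    then obtain t u where tu: "t \<in> D q" "u \<in> D p" "z = t + \<rho> ^ q * u"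
      using D_decompose by blast
    have "0 \<le> u" "u \<le> 1" using D_bounds[OF tu(2)] ratio_pos
      by (auto intro: order_trans[of _ "u + \<rho> ^ p"])
    then have "0 \<le> \<rho> ^ q * u" "\<rho> ^ q * u \<le> \<rho> ^ q"
      using ratio_pos by (simp_all add: mult_left_le)
    moreover have "\<bar>x - z\<bar> < \<rho> ^ q" using z r by (simp add: dist_real_def)
    ultimately have "x - 2 * \<rho> ^ q \<le> t" "t \<le> x + 2 * \<rho> ^ q" using tu(3) by linarith+
    then consider "x - 2 * \<rho> ^ q \<le> t" "t \<le> x - 2 * \<rho> ^ q + \<rho> ^ q"
      | "x - \<rho> ^ q \<le> t" "t \<le> x - \<rho> ^ q + \<rho> ^ q" | "x \<le> t" "t \<le> x + \<rho> ^ q"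
      | "x + \<rho> ^ q \<le> t" "t \<le> x + \<rho> ^ q + \<rho> ^ q"
      by linarith
    then have "t \<in> B" using tu(1) unfolding B_def W_def by cases blast+
    then show "z \<in> (\<lambda>(t, u). t + \<rho> ^ q * u) ` (B \<times> D p)" using tu by force
  qed
  then have "card (D (q + p) \<inter> ball x r) \<le> card ((\<lambda>(t, u). t + \<rho> ^ q * u) ` (B \<times> D p))"
    by (intro card_mono) (simp_all add: finB finite_D)
  also have "\<dots> \<le> card (B \<times> D p)" by (rule card_image_le) (simp add: finB finite_D)
  also have "\<dots> \<le> 4 * C * card (D p)"
    using cardB by (simp add: card_cartesian_product)
  finally show ?thesis .
qed

text \<open>This bounds the weight of a finite cover from below by counting origins of a level \<open>P\<close> so deep that
  all balls are larger than its cells. A ball of radius about \<open>\<rho> ^ q\<close> contains at most the proportion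
  \<open>4 * C\<^sup>2 / card (D q)\<close> of these origins, which the hypothesis on \<open>c\<close> converts into a multiple of the
  \<open>s\<close>-th power of the radius; the proportions add up to at least \<open>1\<close>.\<close>

lemma finite_ball_cover_mass:
  assumes s: "0 \<le> s" and c: "0 < c" "\<And>p. c \<le> card (D p) * (\<rho> ^ p) powr s"
    and J: "finite J" "\<And>j. j \<in> J \<Longrightarrow> 0 < r j \<and> r j < 1"
    and cover: "attractor \<subseteq> (\<Union>j\<in>J. ball (x j) (r j))"
  shows "c * \<rho> powr s \<le> 4 * C\<^sup>2 * (\<Sum>j\<in>J. r j powr s)"
proof -
  have "\<forall>j\<in>J. \<exists>q. \<rho> ^ Suc q \<le> r j \<and> r j < \<rho> ^ q"
    using J(2) ex_power_scale by metis
  then obtain q where q: "\<And>j. j \<in> J \<Longrightarrow> \<rho> ^ Suc (q j) \<le> r j \<and> r j < \<rho> ^ q j" by metis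
  define P where "P = (\<Sum>j\<in>J. q j)"
  have qP: "q j \<le> P" if "j \<in> J" for j
    unfolding P_def using member_le_sum[of j J q] J(1) that by simp
  define N where "N p = real (card (D p))" for p
  have Npos: "0 < N p" for p using card_D_pos by (simp add: N_def)
  have one: "c * \<rho> powr s * card (D P \<inter> ball (x j) (r j)) \<le> 4 * C\<^sup>2 * N P * r j powr s"
    if j: "j \<in> J" for j
  proof -
    \<comment> \<open>Combine the local count in the ball with supermultiplicativity at the scale of the ball.\<close>
    let ?q = "q j" and ?R = "(\<rho> ^ q j) powr s"
    have "card (D (?q + (P - ?q)) \<inter> ball (x j) (r j)) \<le> 4 * C * card (D (P - ?q))"
      by (rule card_D_ball_le) (use q j in \<open>auto intro: less_imp_le\<close>)
    then have "real (card (D P \<inter> ball (x j) (r j))) \<le> real (4 * C * card (D (P - ?q)))"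
      using qP[OF j] by (simp only: of_nat_le_iff le_add_diff_inverse)
    then have le1: "real (card (D P \<inter> ball (x j) (r j))) \<le> 4 * C * N (P - ?q)"
      by (simp add: N_def)
    have "real (card (D ?q) * card (D (P - ?q))) \<le> real (C * card (D (?q + (P - ?q))))"
      using card_D_supermultiplicative of_nat_le_iff by blast
    then have le2: "N ?q * N (P - ?q) \<le> C * N P" using qP[OF j] by (simp add: N_def)
    have "\<rho> powr s * ?R = (\<rho> ^ Suc ?q) powr s"
      using ratio_pos by (simp add: powr_mult)
    also have "\<dots> \<le> r j powr s" using q[OF j] s ratio_pos by (intro powr_mono2) auto
    finally have "\<rho> powr s * ?R \<le> r j powr s" .
    then have le3: "4 * C * (\<rho> powr s * ?R) \<le> 4 * C * (r j powr s)" by (rule mult_left_mono) simp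
    have Nnonneg: "0 \<le> N p" for p using Npos less_imp_le by blast
    have "c * \<rho> powr s * card (D P \<inter> ball (x j) (r j))
        \<le> (N ?q * ?R) * \<rho> powr s * (4 * C * N (P - ?q))"
      using le1 c Npos unfolding N_def by (intro mult_mono) auto
    also have "\<dots> = 4 * C * (\<rho> powr s * ?R) * (N ?q * N (P - ?q))" by (simp add: ac_simps)
    also have "\<dots> \<le> 4 * C * (r j powr s) * (C * N P)"
      by (rule mult_mono[OF le3 le2]) (simp_all add: Nnonneg)
    finally show ?thesis by (simp add: power2_eq_square ac_simps)
  qed
  have "D P = (\<Union>j\<in>J. D P \<inter> ball (x j) (r j))"
    using cover D_subset_attractor[of P] by blast
  then have "card (D P) \<le> (\<Sum>j\<in>J. card (D P \<inter> ball (x j) (r j)))"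
    using card_UN_le[OF J(1), of "\<lambda>j. D P \<inter> ball (x j) (r j)"] by simp
  then have "N P \<le> (\<Sum>j\<in>J. real (card (D P \<inter> ball (x j) (r j))))"
    unfolding N_def by (simp flip: of_nat_sum)
  then have "c * \<rho> powr s * N P \<le> c * \<rho> powr s * (\<Sum>j\<in>J. real (card (D P \<inter> ball (x j) (r j))))"
    using c by (intro mult_left_mono) auto
  also have "\<dots> \<le> (\<Sum>j\<in>J. 4 * C\<^sup>2 * N P * r j powr s)"
    unfolding sum_distrib_left by (rule sum_mono) (rule one)
  also have "\<dots> = 4 * C\<^sup>2 * (\<Sum>j\<in>J. r j powr s) * N P"
    by (simp add: sum_distrib_left ac_simps)
  finally show ?thesis using Npos[of P] by simp
qed

text \<open>A cover of too small a weight could be enlarged to a cover by open balls of still too small a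
  weight. Compactness leaves finitely many of them, and these contradict the bound for finite covers.\<close>

lemma measure_attractor_eq_0_iff:
  assumes s: "0 \<le> s"
  shows "hausdorff_measure s attractor = 0 \<longleftrightarrow> (\<forall>e>0. \<exists>p. card (D p) * (\<rho> ^ p) powr s < e)"
proof (intro iffI, rule ccontr)
  assume null: "hausdorff_measure s attractor = 0"
    and "\<not> (\<forall>e>0. \<exists>p. card (D p) * (\<rho> ^ p) powr s < e)"
  then obtain c where c: "0 < c" "\<And>p. c \<le> card (D p) * (\<rho> ^ p) powr s"
    by (auto simp: not_less)
  \<comment> \<open>The cover will weigh less than \<open>\<eta>\<close> and its enlargement less than \<open>2 * \<eta>\<close>; the summand \<open>1\<close> makes
    the final inequality strict, also when \<open>C = 0\<close>.\<close>
  define \<eta> where "\<eta> = c * \<rho> powr s / (8 * (real C)\<^sup>2 + 1)"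
  have den: "0 < 8 * (real C)\<^sup>2 + 1" by (simp add: add_nonneg_pos)
  have \<eta>: "0 < \<eta>" "(8 * (real C)\<^sup>2 + 1) * \<eta> = c * \<rho> powr s"
    using c(1) ratio_pos den unfolding \<eta>_def by (simp, simp)
  have "hausdorff_premeasure (1/2) s attractor \<le> hausdorff_measure s attractor"
    unfolding hausdorff_measure_def by (rule SUP_upper) simp
  then have "hausdorff_premeasure (1/2) s attractor < ennreal \<eta>" using null \<eta>(1) by simp
  then obtain U where U: "U \<in> hausdorff_covers (1/2) attractor"
      "(\<Sum>i. hausdorff_weight s (U i)) < ennreal \<eta>"
    unfolding hausdorff_premeasure_def by (auto simp: INF_less_iff)
  have bdd: "bounded (U i)" and diam: "diameter (U i) \<le> 1/2" for i
    using U(1) by (auto simp: hausdorff_covers_def)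
  define w where "w i = (if s = 0 then 1 else diameter (U i) powr s)" for i
  define I where "I = {i. U i \<noteq> {}}"
  have weight: "hausdorff_weight s (U i) = ennreal (w i)" if "i \<in> I" for i
    using that by (simp add: I_def w_def hausdorff_weight_def)
  have "\<exists>r. diameter (U i) < r \<and> r < 1 \<and> r powr s \<le> w i + \<eta> * (1/2) ^ Suc i" for i
  proof -
    have "0 \<le> diameter (U i)" "diameter (U i) < 1" "0 < \<eta> * (1/2) ^ Suc i"
      using diameter_ge_0[OF bdd[of i]] diam[of i] \<eta>(1) by auto
    from ex_slightly_larger_radius[OF this(1,2) s this(3)] show ?thesis
      unfolding w_def by blast
  qed
  then obtain r where r: "\<And>i. diameter (U i) < r i" "\<And>i. r i < 1"
      "\<And>i. r i powr s \<le> w i + \<eta> * (1/2) ^ Suc i" by metis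
  have rpos: "0 < r i" for i using r(1) diameter_ge_0[OF bdd] le_less_trans by blast
  have "\<forall>i\<in>I. \<exists>x. x \<in> U i" by (auto simp: I_def)
  then obtain x where x: "\<And>i. i \<in> I \<Longrightarrow> x i \<in> U i" by metis
  have "U i \<subseteq> ball (x i) (r i)" if "i \<in> I" for i
    using diameter_bounded_bound[OF bdd x[OF that]] r(1)[of i] by force
  moreover have "attractor \<subseteq> (\<Union>i\<in>I. U i)"
  proof -
    have "attractor \<subseteq> (\<Union>i. U i)" using U(1) by (simp add: hausdorff_covers_def)
    then show ?thesis unfolding I_def by blast
  qed
  ultimately have "attractor \<subseteq> (\<Union>i\<in>I. ball (x i) (r i))"
    by (meson UN_mono order_refl order_trans)
  then obtain J where J: "J \<subseteq> I" "finite J" "attractor \<subseteq> (\<Union>i\<in>J. ball (x i) (r i))"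
    using compactE_image[OF compact_attractor, of I "\<lambda>i. ball (x i) (r i)"] by auto
  have "c * \<rho> powr s \<le> 4 * C\<^sup>2 * (\<Sum>j\<in>J. r j powr s)"
    using finite_ball_cover_mass[OF s c J(2) _ J(3)] rpos r(2) by simp
  also have "(\<Sum>j\<in>J. r j powr s) \<le> 2 * \<eta>"
  proof -
    have "ennreal (\<Sum>j\<in>J. w j) = (\<Sum>j\<in>J. ennreal (w j))"
      by (intro sum_ennreal[symmetric]) (simp add: w_def)
    also have "\<dots> = (\<Sum>j\<in>J. hausdorff_weight s (U j))"
      using J(1) weight by (intro sum.cong) auto
    also have "\<dots> \<le> (\<Sum>i. hausdorff_weight s (U i))"
      by (rule sum_le_suminf) (auto simp: J(2) summableI)
    also note U(2)
    finally have "(\<Sum>j\<in>J. w j) < \<eta>" using \<eta>(1) by (simp add: ennreal_less_iff sum_nonneg w_def)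
    moreover have "(\<Sum>j\<in>J. (1/2::real) ^ Suc j) \<le> 1"
      using sum_le_suminf[OF sums_summable[OF power_half_series] J(2)]
        sums_unique[OF power_half_series] by simp
    then have "\<eta> * (\<Sum>j\<in>J. (1/2) ^ Suc j) \<le> \<eta> * 1"
      using \<eta>(1) by (intro mult_left_mono) auto
    then have "(\<Sum>j\<in>J. \<eta> * (1/2) ^ Suc j) \<le> \<eta>"
      by (simp only: sum_distrib_left mult_1_right)
    moreover have "(\<Sum>j\<in>J. r j powr s) \<le> (\<Sum>j\<in>J. w j) + (\<Sum>j\<in>J. \<eta> * (1/2) ^ Suc j)"
      unfolding sum.distrib[symmetric] by (rule sum_mono) (rule r(3))
    ultimately show ?thesis by linarith
  qed
  then have "4 * C\<^sup>2 * (\<Sum>j\<in>J. r j powr s) \<le> 4 * C\<^sup>2 * (2 * \<eta>)"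
    by (intro mult_left_mono) auto
  finally have "c * \<rho> powr s \<le> 8 * (real C)\<^sup>2 * \<eta>" by simp
  then show False using \<eta> by (simp add: distrib_right)
qed (use measure_attractor_eq_0[OF s] in blast)

end

end

section \<open>Exact overlaps\<close>

text \<open>Inclusion and exclusion stops at pairs of neighbours, since the part of \<open>A (Suc m)\<close> already
  covered is just its intersection with \<open>A m\<close>.\<close>

lemma card_UN_chain:
  assumes "\<And>i. finite (A i)"
    and "\<And>i j. \<lbrakk>1 \<le> i; i < j; j \<le> m; j \<noteq> Suc i\<rbrakk> \<Longrightarrow> A i \<inter> A j = {}"
  shows "card (\<Union>i\<in>{1..m}. A i) + (\<Sum>i\<in>{1..<m}. card (A i \<inter> A (Suc i))) = (\<Sum>i\<in>{1..m}. card (A i))"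
  using assms(2)
proof (induction m)
  case (Suc m)
  let ?B = "\<Union>i\<in>{1..m}. A i"
  have IH: "card ?B + (\<Sum>i\<in>{1..<m}. card (A i \<inter> A (Suc i))) = (\<Sum>i\<in>{1..m}. card (A i))"
    using Suc by simp
  show ?case
  proof (cases "m = 0")
    case False
    have "?B \<inter> A (Suc m) = A m \<inter> A (Suc m)"
    proof -
      have "A i \<inter> A (Suc m) = {}" if "i \<in> {1..m}" "i \<noteq> m" for i
        using that by (intro Suc.prems) auto
      then have "x \<in> A m" if "x \<in> A i" "x \<in> A (Suc m)" "i \<in> {1..m}" for x i
        using that by blast
      moreover have "m \<in> {1..m}" using False by simp
      ultimately show ?thesis by blast
    qed
    moreover have "card (?B \<union> A (Suc m)) + card (?B \<inter> A (Suc m)) = card ?B + card (A (Suc m))"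
      using assms(1) by (intro card_Un_Int[symmetric]) auto
    moreover have "(\<Union>i\<in>{1..Suc m}. A i) = ?B \<union> A (Suc m)"
      by (auto simp: atLeastAtMostSuc_conv)
    moreover have "{1..<Suc m} = insert m {1..<m}" using False by auto
    ultimately show ?thesis using IH by simp
  qed simp
qed simp

locale overlap_ifs =
  fixes \<rho> :: real and m n :: nat and k :: "nat \<Rightarrow> nat" and a :: "nat \<Rightarrow> real"
  assumes ratio: "0 < \<rho>" "\<rho> < 1"
    and m_pos: "1 \<le> m"
    and k_inj: "inj_on k {1..n}"
    and k_pos: "l \<in> {1..n} \<Longrightarrow> 1 \<le> k l"
    and overlap: "a \<in> overlap_class \<rho> m n k"
begin

lemma interval_eq: "ifs_interval \<rho> a i = {a i..a i + \<rho>}"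
  using image_affinity_atLeastAtMost[of \<rho> "a i" 0 1] ratio
  by (simp add: ifs_interval_def ifs_map_def[abs_def] algebra_simps)

lemma extreme_translations: "a 1 = 0" "a m = 1 - \<rho>"
  by (insert overlap[unfolded overlap_class_def mem_Collect_eq], elim conjE, assumption)+

lemma a_less_Suc: "\<forall>i\<in>{1..<m}. a i < a (Suc i)"
  by (insert overlap[unfolded overlap_class_def mem_Collect_eq], elim conjE)

lemma a_strict_mono: "1 \<le> i \<Longrightarrow> i < j \<Longrightarrow> j \<le> m \<Longrightarrow> a i < a j"
proof (induction j)
  case (Suc j)
  have "a j < a (Suc j)" using Suc.prems a_less_Suc by auto
  then show ?case using Suc by (cases "i = j") auto
qed simp

sublocale line_ifs \<rho> m a
proof
  fix i assume "i \<in> {1..m}"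
  then show "0 \<le> a i \<and> a i \<le> 1 - \<rho>"
    using a_strict_mono[of 1 i] a_strict_mono[of i m] extreme_translations by (cases "i = 1"; cases "i = m") auto
qed (use ratio m_pos extreme_translations in auto)

text \<open>Two intervals that meet without being neighbours would meet a third one between them in the left
  endpoint of the right interval. For neighbours the length of the overlap determines the gap of the
  translations.\<close>

lemma overlap_length:
  assumes ij: "1 \<le> i" "i < j" "j \<le> m" and meet: "a j \<le> a i + \<rho>"
  shows "j = Suc i \<and> (\<exists>l\<in>{1..n}. a (Suc i) = a i + \<rho> - \<rho> ^ k l)"
proof -
  have "a i < a j" using ij by (rule a_strict_mono)
  have "j = Suc i"
  proof (rule ccontr)
    assume "j \<noteq> Suc i"
    then have "a i < a (Suc i)" "a (Suc i) < a j" using ij by (auto intro!: a_strict_mono)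
    then have "a j \<in> ifs_interval \<rho> a i \<inter> ifs_interval \<rho> a (Suc i) \<inter> ifs_interval \<rho> a j"
      using meet ratio by (simp add: interval_eq)
    moreover have "i \<in> {1..m}" "Suc i \<in> {1..m}" "j \<in> {1..m}" "i \<noteq> Suc i" "i \<noteq> j" "Suc i \<noteq> j"
      using ij \<open>j \<noteq> Suc i\<close> by auto
    ultimately show False using overlap unfolding overlap_class_def by blast
  qed
  moreover have int: "ifs_interval \<rho> a i \<inter> ifs_interval \<rho> a j = {a j..a i + \<rho>}"
    using \<open>a i < a j\<close> by (auto simp: interval_eq)
  have "measure lborel (ifs_interval \<rho> a i \<inter> ifs_interval \<rho> a j) \<in> {\<rho> ^ k l | l. l \<in> {1..n}}"
  proof -
    have "ifs_interval \<rho> a i \<inter> ifs_interval \<rho> a j \<noteq> {}" using int meet by simp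
    moreover have "i \<in> {1..m}" "j \<in> {1..m}" using ij by auto
    ultimately show ?thesis using overlap ij(2) unfolding overlap_class_def by blast
  qed
  then obtain l where "l \<in> {1..n}" "a i + \<rho> - a j = \<rho> ^ k l"
    using int meet by auto
  ultimately show ?thesis by (auto intro!: bexI[of _ l])
qed

lemma overlap_indices_eq:
  "overlap_indices \<rho> m k a l = {i\<in>{1..<m}. a (Suc i) = a i + \<rho> - \<rho> ^ k l}"
proof -
  have "measure lborel (ifs_interval \<rho> a i \<inter> ifs_interval \<rho> a (Suc i)) = \<rho> ^ k l
      \<longleftrightarrow> a (Suc i) = a i + \<rho> - \<rho> ^ k l" if "i \<in> {1..<m}" for i
  proof -
    have "a i < a (Suc i)" using that by (intro a_strict_mono) auto
    then have int: "ifs_interval \<rho> a i \<inter> ifs_interval \<rho> a (Suc i) = {a (Suc i)..a i + \<rho>}"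
      by (auto simp: interval_eq)
    have "0 < \<rho> ^ k l" using ratio by simp
    then show ?thesis unfolding int using ratio by (cases "a (Suc i) \<le> a i + \<rho>") auto
  qed
  moreover have "{1..m - 1} = {1..<m}" using m_pos by auto
  ultimately show ?thesis unfolding overlap_indices_def by auto
qed

lemma end_interval_isolated:
  "(\<forall>j\<in>{1<..m}. \<rho> < a j) \<or> (\<forall>j\<in>{1..<m}. a j + \<rho> < a m)"
proof -
  have "\<rho> < a j" if "ifs_interval \<rho> a 1 \<inter> ifs_interval \<rho> a j = {}" "j \<in> {1<..m}" for j
  proof (rule ccontr)
    assume "\<not> \<rho> < a j"
    then have "a j \<in> ifs_interval \<rho> a 1 \<inter> ifs_interval \<rho> a j"
      using a_strict_mono[of 1 j] that(2) extreme_translations ratio by (auto simp: interval_eq)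
    then show False using that(1) by blast
  qed
  moreover have "a j + \<rho> < a m" if "ifs_interval \<rho> a m \<inter> ifs_interval \<rho> a j = {}" "j \<in> {1..<m}" for j
  proof (rule ccontr)
    assume "\<not> a j + \<rho> < a m"
    then have "a m \<in> ifs_interval \<rho> a m \<inter> ifs_interval \<rho> a j"
      using a_strict_mono[of j m] that(2) ratio by (auto simp: interval_eq)
    then show False using that(1) by blast
  qed
  moreover have "(\<forall>j\<in>{1<..m}. ifs_interval \<rho> a 1 \<inter> ifs_interval \<rho> a j = {}) \<or>
      (\<forall>j\<in>{1..<m}. ifs_interval \<rho> a m \<inter> ifs_interval \<rho> a j = {})"
    using overlap by (simp only: overlap_class_def mem_Collect_eq)
  ultimately show ?thesis by metis
qed

text \<open>When the first interval is isolated, so is the corresponding cell at every level \<open>q\<close>: it is the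
  image of the whole picture under a power of the first map. A cell that merely touches \<open>[0, \<rho> ^ q]\<close>
  therefore descends from it.\<close>

lemma cell_in_first:
  assumes iso: "\<forall>j\<in>{1<..m}. \<rho> < a j"
  shows "\<lbrakk>v \<in> D p; q \<le> p; v \<le> \<rho> ^ q\<rbrakk> \<Longrightarrow> \<exists>u\<in>D (p - q). v = \<rho> ^ q * u"
proof (induction q arbitrary: p v)
  case (Suc q)
  then obtain p' where p': "p = Suc p'" by (cases p) auto
  obtain i v' where iv: "i \<in> {1..m}" "v' \<in> D p'" "v = \<rho> * v' + a i"
    using Suc.prems(1) unfolding p' by (rule D_SucE)
  have "\<rho> ^ Suc q \<le> \<rho>" using power_decreasing[of 1 "Suc q" \<rho>] ratio by simp
  moreover have "0 \<le> \<rho> * v'" using D_bounds[OF iv(2)] ratio by simp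
  ultimately have "a i \<le> \<rho>" using Suc.prems(3) iv(3) by linarith
  then have "i = 1" using iso iv(1) by (metis atLeastAtMost_iff greaterThanAtMost_iff le_neq_implies_less linorder_not_less)
  then have v: "v = \<rho> * v'" using iv(3) extreme_translations by simp
  then have "\<rho> * v' \<le> \<rho> * \<rho> ^ q" using Suc.prems(3) by simp
  then have "v' \<le> \<rho> ^ q" using ratio by simp
  then obtain u where "u \<in> D (p' - q)" "v' = \<rho> ^ q * u"
    using Suc.IH[of v' p'] iv(2) Suc.prems(2) p' by auto
  then show ?case using v p' by (auto intro!: bexI[of _ u])
qed auto

text \<open>The mirror image: \<open>[1 - \<rho> ^ q, 1]\<close> is the cell of a power of the last map.\<close>

lemma cell_in_last:
  assumes iso: "\<forall>j\<in>{1..<m}. a j + \<rho> < a m"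
  shows "\<lbrakk>v \<in> D p; q \<le> p; 1 - \<rho> ^ q \<le> v + \<rho> ^ p\<rbrakk> \<Longrightarrow> \<exists>u\<in>D (p - q). v = 1 - \<rho> ^ q + \<rho> ^ q * u"
proof (induction q arbitrary: p v)
  case (Suc q)
  then obtain p' where p': "p = Suc p'" by (cases p) auto
  obtain i v' where iv: "i \<in> {1..m}" "v' \<in> D p'" "v = \<rho> * v' + a i"
    using Suc.prems(1) unfolding p' by (rule D_SucE)
  have "\<rho> ^ Suc q \<le> \<rho>" using power_decreasing[of 1 "Suc q" \<rho>] ratio by simp
  moreover have "\<rho> * (v' + \<rho> ^ p') \<le> \<rho> * 1"
    using D_bounds[OF iv(2)] ratio by (intro mult_left_mono) auto
  then have "\<rho> * v' + \<rho> ^ p \<le> \<rho>" by (simp add: p' algebra_simps)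
  ultimately have "a m \<le> a i + \<rho>" using Suc.prems(3) iv(3) extreme_translations by linarith
  then have "i = m" using iso iv(1) by (metis atLeastAtMost_iff atLeastLessThan_iff le_neq_implies_less linorder_not_less)
  then have v: "v = \<rho> * v' + 1 - \<rho>" using iv(3) extreme_translations by simp
  then have "\<rho> * (1 - \<rho> ^ q) \<le> \<rho> * (v' + \<rho> ^ p')"
    using Suc.prems(3) by (simp add: p' algebra_simps)
  then have "1 - \<rho> ^ q \<le> v' + \<rho> ^ p'" using ratio by (simp only: mult_le_cancel_left_pos)
  then obtain u where u: "u \<in> D (p' - q)" "v' = 1 - \<rho> ^ q + \<rho> ^ q * u"
    using Suc.IH[of v' p'] iv(2) Suc.prems(2) p' by auto
  have "v = 1 - \<rho> ^ Suc q + \<rho> ^ Suc q * u" unfolding v u(2) by (simp add: algebra_simps)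
  then show ?case using u(1) p' by (intro bexI[of _ u]) auto
qed auto

text \<open>The rightmost cell of level \<open>k l - 1\<close> in the left interval coincides, as an affine image, with the
  leftmost one in the right interval. Its descendants belong to both intervals.\<close>

lemma common_cell:
  assumes l: "l \<in> {1..n}" "a (Suc i) = a i + \<rho> - \<rho> ^ k l" "k l \<le> Suc p"
    and u: "u \<in> D (Suc p - k l)"
  shows "\<exists>v\<in>D p. a (Suc i) + \<rho> ^ k l * u = \<rho> * v + a i"
    and "\<exists>v\<in>D p. a (Suc i) + \<rho> ^ k l * u = \<rho> * v + a (Suc i)"
proof -
  obtain q where q: "k l = Suc q" using k_pos[OF l(1)] by (cases "k l") auto
  have "Suc p - k l = p - q" "q + (p - q) = p" using q l(3) by auto
  then have "1 - \<rho> ^ q + \<rho> ^ q * u \<in> D p" "0 + \<rho> ^ q * u \<in> D p"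
    using D_compose[OF last_in_D[of q], of u "p - q"] D_compose[OF zero_in_D[of q], of u "p - q"] u
    by auto
  then show "\<exists>v\<in>D p. a (Suc i) + \<rho> ^ k l * u = \<rho> * v + a i"
    and "\<exists>v\<in>D p. a (Suc i) + \<rho> ^ k l * u = \<rho> * v + a (Suc i)"
    using l(2) q by (force simp: algebra_simps)+
qed

text \<open>A cell of the left interval that reaches a cell of the right one touches the overlap, and vice
  versa. On the side where the outermost interval is isolated, touching the overlap forces descent
  from the common cell. Which of the two cells this is depends on the side, hence the disjunction.\<close>

lemma close_cells_in_overlap:
  assumes l: "l \<in> {1..n}" "a (Suc i) = a i + \<rho> - \<rho> ^ k l" "k l \<le> Suc p"
    and v: "v \<in> D p" "v' \<in> D p"
    and close: "\<rho> * v' + a (Suc i) \<le> \<rho> * v + a i + \<rho> ^ Suc p"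
  shows "(\<exists>u\<in>D (Suc p - k l). \<rho> * v + a i = a (Suc i) + \<rho> ^ k l * u) \<or>
    (\<exists>u\<in>D (Suc p - k l). \<rho> * v' + a (Suc i) = a (Suc i) + \<rho> ^ k l * u)"
proof -
  obtain q where q: "k l = Suc q" using k_pos[OF l(1)] by (cases "k l") auto
  have qp: "Suc p - k l = p - q" "q \<le> p" using q l(3) by auto
  from end_interval_isolated show ?thesis
  proof
    assume iso: "\<forall>j\<in>{1<..m}. \<rho> < a j"
    have "\<rho> * (v + \<rho> ^ p) \<le> \<rho> * 1"
      using D_bounds[OF v(1)] ratio by (intro mult_left_mono) auto
    then have "\<rho> * v' \<le> \<rho> * \<rho> ^ q" using close l(2) q by (simp add: algebra_simps)
    then have "v' \<le> \<rho> ^ q" using ratio by simp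
    then obtain u where "u \<in> D (p - q)" "v' = \<rho> ^ q * u"
      using cell_in_first[OF iso v(2) qp(2)] by blast
    then show ?thesis using q qp by (intro disjI2 bexI[of _ u]) auto
  next
    assume iso: "\<forall>j\<in>{1..<m}. a j + \<rho> < a m"
    have "0 \<le> \<rho> * v'" using D_bounds[OF v(2)] ratio by simp
    then have "\<rho> * (1 - \<rho> ^ q) \<le> \<rho> * (v + \<rho> ^ p)" using close l(2) q by (simp add: algebra_simps)
    then have "1 - \<rho> ^ q \<le> v + \<rho> ^ p" using ratio by (simp only: mult_le_cancel_left_pos)
    then obtain u where u: "u \<in> D (p - q)" "v = 1 - \<rho> ^ q + \<rho> ^ q * u"
      using cell_in_last[OF iso v(1) qp(2)] by blast
    have "\<rho> * v + a i = a (Suc i) + \<rho> ^ k l * u"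
      unfolding u(2) l(2) q by (simp add: algebra_simps)
    then show ?thesis using u(1) qp(1) by auto
  qed
qed

lemma close_cells_meet:
  assumes "v \<in> D p" "v' \<in> D p" "\<rho> * v' + a j \<le> \<rho> * v + a i + \<rho> ^ Suc p"
  shows "a j \<le> a i + \<rho>"
proof -
  have "\<rho> * (v + \<rho> ^ p) \<le> \<rho> * 1"
    using D_bounds[OF assms(1)] ratio by (intro mult_left_mono) auto
  moreover have "0 \<le> \<rho> * v'" using D_bounds[OF assms(2)] ratio by simp
  ultimately show ?thesis using assms(3) by (simp add: algebra_simps)
qed

text \<open>If the cells come from different first-level intervals, one of them descends from the common cell
  of the overlap and so can be read as a cell of the other interval. After this change both carry the
  same first map, which can be stripped.\<close>

lemma close_cells_common_parent:
  assumes t: "t \<in> D (Suc p)" "t' \<in> D (Suc p)" "\<bar>t - t'\<bar> \<le> \<rho> ^ Suc p"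
    and p: "\<And>l. l \<in> {1..n} \<Longrightarrow> k l \<le> Suc p"
  shows "\<exists>v\<in>D p. \<exists>v'\<in>D p. t - t' = \<rho> * (v - v')"
proof -
  have less: "\<exists>w\<in>D p. \<exists>w'\<in>D p. (\<rho> * v + a i) - (\<rho> * v' + a j) = \<rho> * (w - w')"
    if ij: "1 \<le> i" "i < j" "j \<le> m" and v: "v \<in> D p" "v' \<in> D p"
      and close: "\<rho> * v' + a j \<le> \<rho> * v + a i + \<rho> ^ Suc p" for i j v v'
  proof -
    obtain l where j: "j = Suc i" and l: "l \<in> {1..n}" "a (Suc i) = a i + \<rho> - \<rho> ^ k l"
      using overlap_length[OF ij close_cells_meet[OF v close]] by blast
    note l = l p[OF l(1)]
    from close_cells_in_overlap[OF l v close[unfolded j]] show ?thesis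
    proof (elim disjE bexE)
      fix u assume u: "u \<in> D (Suc p - k l)" "\<rho> * v + a i = a (Suc i) + \<rho> ^ k l * u"
      obtain w where "w \<in> D p" "a (Suc i) + \<rho> ^ k l * u = \<rho> * w + a (Suc i)"
        using common_cell(2)[OF l u(1)] by blast
      then have "\<rho> * v + a i - (\<rho> * v' + a j) = \<rho> * (w - v')"
        using u(2) j by (simp add: right_diff_distrib)
      then show ?thesis using \<open>w \<in> D p\<close> v(2) by blast
    next
      fix u assume u: "u \<in> D (Suc p - k l)" "\<rho> * v' + a (Suc i) = a (Suc i) + \<rho> ^ k l * u"
      obtain w where "w \<in> D p" "a (Suc i) + \<rho> ^ k l * u = \<rho> * w + a i"
        using common_cell(1)[OF l u(1)] by blast
      then have "\<rho> * v + a i - (\<rho> * v' + a j) = \<rho> * (v - w)"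
        using u(2) j by (simp add: right_diff_distrib)
      then show ?thesis using \<open>w \<in> D p\<close> v(1) by blast
    qed
  qed
  obtain i v where i: "i \<in> {1..m}" "v \<in> D p" "t = \<rho> * v + a i" using t(1) by (rule D_SucE)
  obtain j v' where j: "j \<in> {1..m}" "v' \<in> D p" "t' = \<rho> * v' + a j" using t(2) by (rule D_SucE)
  consider "i = j" | "i < j" | "j < i" by linarith
  then show ?thesis
  proof cases
    case 1
    then have "t - t' = \<rho> * (v - v')" using i(3) j(3) by (simp add: right_diff_distrib)
    then show ?thesis using i(2) j(2) by blast
  next
    case 2
    then show ?thesis using less[of i j v v'] i j t(3) by auto
  next
    case 3
    have "\<rho> * v + a i \<le> \<rho> * v' + a j + \<rho> ^ Suc p"
      using t(3) unfolding i(3) j(3) by linarith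
    then obtain w w' where "w \<in> D p" "w' \<in> D p" "t' - t = \<rho> * (w - w')"
      using less[of j i v' v] i j 3 by auto
    moreover from this have "t - t' = \<rho> * (w' - w)" by (simp add: right_diff_distrib)
    ultimately show ?thesis by blast
  qed
qed

text \<open>Any upper bound for all the exponents \<open>k l\<close> serves; the sum avoids a maximum over a possibly empty
  set.\<close>

definition level_bound :: nat where "level_bound = (\<Sum>l\<in>{1..n}. k l)"

text \<open>Stripping common first maps preserves the difference relative to the length of the cells, and it is
  possible as long as the level exceeds all overlap exponents. Thus the relative position of two
  cells that meet already occurs at a bounded level.\<close>

lemma close_cells_difference:
  "\<lbrakk>t \<in> D p; t' \<in> D p; \<bar>t - t'\<bar> \<le> \<rho> ^ p\<rbrakk>
    \<Longrightarrow> \<exists>q\<le>level_bound. \<exists>u\<in>D q. \<exists>u'\<in>D q. (t - t') / \<rho> ^ p = (u - u') / \<rho> ^ q"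
proof (induction p arbitrary: t t')
  case (Suc p)
  show ?case
  proof (cases "Suc p \<le> level_bound")
    case False
    have "k l \<le> Suc p" if "l \<in> {1..n}" for l
      using member_le_sum[of l "{1..n}" k] that False by (simp add: level_bound_def)
    then obtain v v' where v: "v \<in> D p" "v' \<in> D p" "t - t' = \<rho> * (v - v')"
      using close_cells_common_parent[OF Suc.prems] by blast
    have "\<rho> * \<bar>v - v'\<bar> \<le> \<rho> * \<rho> ^ p" using Suc.prems(3) ratio unfolding v(3) by (simp add: abs_mult)
    then have "\<bar>v - v'\<bar> \<le> \<rho> ^ p" using ratio by simp
    moreover have "(t - t') / \<rho> ^ Suc p = (v - v') / \<rho> ^ p" using ratio by (simp add: v(3))
    ultimately show ?thesis using Suc.IH[OF v(1,2)] by simp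
  qed (use Suc.prems in blast)
qed auto

text \<open>Relative to one origin in the window, the others have positions in a finite set that does not
  depend on the level.\<close>

lemma ex_window_bound: "\<exists>C. \<forall>p y. card {t \<in> D p. y \<le> t \<and> t \<le> y + \<rho> ^ p} \<le> C"
proof -
  define E where "E = (\<Union>q\<in>{..level_bound}. (\<lambda>(u, u'). (u - u') / \<rho> ^ q) ` (D q \<times> D q))"
  have finE: "finite E" by (simp add: E_def finite_D)
  have "card {t \<in> D p. y \<le> t \<and> t \<le> y + \<rho> ^ p} \<le> card E" (is "card ?W \<le> _") for p y
  proof (cases "?W = {}")
    case False
    then obtain t0 where t0: "t0 \<in> ?W" by blast
    have "inj_on (\<lambda>t. (t - t0) / \<rho> ^ p) ?W" using ratio by (auto simp: inj_on_def)
    moreover have "(\<lambda>t. (t - t0) / \<rho> ^ p) ` ?W \<subseteq> E"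
    proof clarify
      fix t assume t: "t \<in> D p" "y \<le> t" "t \<le> y + \<rho> ^ p"
      then have "\<bar>t - t0\<bar> \<le> \<rho> ^ p" using t0 by (auto simp: abs_le_iff)
      then obtain q u u' where "q \<le> level_bound" "u \<in> D q" "u' \<in> D q"
          "(t - t0) / \<rho> ^ p = (u - u') / \<rho> ^ q"
        using close_cells_difference[of t p t0] t(1) t0 by auto
      then show "(t - t0) / \<rho> ^ p \<in> E" unfolding E_def by force
    qed
    ultimately show ?thesis using finE by (rule card_inj_on_le)
  next
    case True
    then show ?thesis by (simp only: card.empty)
  qed
  then show ?thesis by blast
qed

text \<open>A cell in the overlap lies in both intervals, and so either alternative of
  \<open>close_cells_in_overlap\<close> makes it a descendant of the common cell. If the overlap is shorter than a
  cell of level \<open>Suc p\<close>, it contains none.\<close>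

lemma card_overlap:
  assumes l: "l \<in> {1..n}" "a (Suc i) = a i + \<rho> - \<rho> ^ k l"
  shows "card (ifs_map \<rho> a i ` D p \<inter> ifs_map \<rho> a (Suc i) ` D p)
    = (if k l \<le> Suc p then card (D (Suc p - k l)) else 0)"
proof (cases "k l \<le> Suc p")
  case True
  note l = l True
  have "ifs_map \<rho> a i ` D p \<inter> ifs_map \<rho> a (Suc i) ` D p
      = (\<lambda>u. a (Suc i) + \<rho> ^ k l * u) ` D (Suc p - k l)"
  proof
    show "(\<lambda>u. a (Suc i) + \<rho> ^ k l * u) ` D (Suc p - k l)
        \<subseteq> ifs_map \<rho> a i ` D p \<inter> ifs_map \<rho> a (Suc i) ` D p"
      using common_cell[OF l] unfolding ifs_map_def by blast
    show "ifs_map \<rho> a i ` D p \<inter> ifs_map \<rho> a (Suc i) ` D p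
        \<subseteq> (\<lambda>u. a (Suc i) + \<rho> ^ k l * u) ` D (Suc p - k l)"
    proof clarify
      fix x v v' assume x: "ifs_map \<rho> a i v = ifs_map \<rho> a (Suc i) v'" and v: "v \<in> D p" "v' \<in> D p"
      have "\<rho> * v' + a (Suc i) \<le> \<rho> * v + a i + \<rho> ^ Suc p"
        using x ratio by (simp add: ifs_map_def)
      from close_cells_in_overlap[OF l v this]
      show "ifs_map \<rho> a i v \<in> (\<lambda>u. a (Suc i) + \<rho> ^ k l * u) ` D (Suc p - k l)"
        using x unfolding ifs_map_def by auto
    qed
  qed
  moreover have "inj_on (\<lambda>u. a (Suc i) + \<rho> ^ k l * u) (D (Suc p - k l))"
    using ratio by (auto simp: inj_on_def)
  ultimately show ?thesis using True by (simp add: card_image)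
next
  case False
  have "ifs_map \<rho> a i v \<noteq> ifs_map \<rho> a (Suc i) v'" if v: "v \<in> D p" "v' \<in> D p" for v v'
  proof
    assume "ifs_map \<rho> a i v = ifs_map \<rho> a (Suc i) v'"
    then have eq: "\<rho> * v + a i = \<rho> * v' + a (Suc i)" by (simp add: ifs_map_def)
    have "\<rho> * (v + \<rho> ^ p) \<le> \<rho> * 1"
      using D_bounds[OF v(1)] ratio by (intro mult_left_mono) auto
    moreover have "0 \<le> \<rho> * v'" using D_bounds[OF v(2)] ratio by simp
    moreover have "\<rho> ^ k l < \<rho> ^ Suc p" using False ratio by (intro power_strict_decreasing) auto
    ultimately show False using eq l(2) by (simp add: algebra_simps)
  qed
  then have "ifs_map \<rho> a i ` D p \<inter> ifs_map \<rho> a (Suc i) ` D p = {}" by blast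
  then show ?thesis using False by simp
qed

text \<open>The cells of level \<open>Suc p\<close> are \<open>m\<close> copies of those of level \<open>p\<close>, from which the cells shared by
  neighbouring copies have to be subtracted once.\<close>

lemma card_D_recursion:
  "card (D (Suc p)) + (\<Sum>l\<in>{1..n}. card (overlap_indices \<rho> m k a l) *
      (if k l \<le> Suc p then card (D (Suc p - k l)) else 0)) = m * card (D p)"
proof -
  let ?A = "\<lambda>i. ifs_map \<rho> a i ` D p" and ?O = "overlap_indices \<rho> m k a"
  define c where "c l = (if k l \<le> Suc p then card (D (Suc p - k l)) else 0)" for l
  have disjoint: "?A i \<inter> ?A j = {}"
    if ij: "1 \<le> i" "i < j" "j \<le> m" and no: "\<not> (j = Suc i \<and> (\<exists>l\<in>{1..n}. i \<in> ?O l))" for i j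
  proof (rule ccontr)
    assume "?A i \<inter> ?A j \<noteq> {}"
    then obtain v v' where v: "v \<in> D p" "v' \<in> D p" and eq: "\<rho> * v + a i = \<rho> * v' + a j"
      by (auto simp: ifs_map_def)
    have "a j \<le> a i + \<rho>" using eq ratio by (intro close_cells_meet[OF v]) simp
    from overlap_length[OF ij this] show False using no ij by (auto simp: overlap_indices_eq)
  qed
  have card_int: "card (?A i \<inter> ?A (Suc i)) = (\<Sum>l\<in>{1..n}. if i \<in> ?O l then c l else 0)"
    if i: "i \<in> {1..<m}" for i
  proof (cases "\<exists>l\<in>{1..n}. i \<in> ?O l")
    case True
    then obtain l where l: "l \<in> {1..n}" "i \<in> ?O l" by blast
    \<comment> \<open>The exponents are distinct, so each overlap is counted under one index only.\<close>
    have "l' = l" if "l' \<in> {1..n}" "i \<in> ?O l'" for l'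
    proof -
      have "\<rho> ^ k l' = \<rho> ^ k l" using that(2) l(2) by (simp add: overlap_indices_eq)
      then have "k l' = k l"
        using power_strict_decreasing[of "k l" "k l'" \<rho>] power_strict_decreasing[of "k l'" "k l" \<rho>] ratio
        by (cases "k l" "k l'" rule: linorder_cases) auto
      then show ?thesis using k_inj that(1) l(1) by (auto dest: inj_onD)
    qed
    then have "(\<Sum>l'\<in>{1..n}. if i \<in> ?O l' then c l' else 0) = (\<Sum>l'\<in>{1..n}. if l' = l then c l' else 0)"
      using l by (intro sum.cong refl if_cong) blast
    also have "\<dots> = c l" using l(1) by simp
    finally show ?thesis using card_overlap[OF l(1), of i p] l(2) by (simp add: c_def overlap_indices_eq)
  next
    case False
    then have "?A i \<inter> ?A (Suc i) = {}" using i by (intro disjoint) auto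
    then show ?thesis using False by simp
  qed
  have "(\<Sum>i\<in>{1..<m}. card (?A i \<inter> ?A (Suc i)))
      = (\<Sum>i\<in>{1..<m}. \<Sum>l\<in>{1..n}. if i \<in> ?O l then c l else 0)"
    by (intro sum.cong card_int) auto
  also have "\<dots> = (\<Sum>l\<in>{1..n}. \<Sum>i\<in>{1..<m}. if i \<in> ?O l then c l else 0)" by (rule sum.swap)
  also have "\<dots> = (\<Sum>l\<in>{1..n}. card (?O l) * c l)"
  proof (rule sum.cong[OF refl])
    fix l
    have "{1..<m} \<inter> ?O l = ?O l" by (auto simp: overlap_indices_eq)
    then show "(\<Sum>i\<in>{1..<m}. if i \<in> ?O l then c l else 0) = card (?O l) * c l"
      by (simp flip: sum.inter_restrict)
  qed
  finally have "(\<Sum>i\<in>{1..<m}. card (?A i \<inter> ?A (Suc i))) = (\<Sum>l\<in>{1..n}. card (?O l) * c l)" .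
  moreover have "card (\<Union>i\<in>{1..m}. ?A i) + (\<Sum>i\<in>{1..<m}. card (?A i \<inter> ?A (Suc i)))
      = (\<Sum>i\<in>{1..m}. card (?A i))"
  proof (rule card_UN_chain)
    show "?A i \<inter> ?A j = {}" if "1 \<le> i" "i < j" "j \<le> m" "j \<noteq> Suc i" for i j
      by (rule disjoint) (use that in auto)
  qed (simp add: finite_D)
  moreover have "card (?A i) = card (D p)" for i
    using ratio by (intro card_image) (auto simp: inj_on_def ifs_map_def)
  ultimately show ?thesis unfolding c_def by simp
qed

end

lemma card_cell_origins_eq:
  assumes "overlap_ifs \<rho> m n k a" "overlap_ifs \<rho> m n k b"
    and same: "\<forall>l\<in>{1..n}. card (overlap_indices \<rho> m k a l) = card (overlap_indices \<rho> m k b l)"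
  shows "card (cell_origins \<rho> m a p) = card (cell_origins \<rho> m b p)"
proof (induction p rule: less_induct)
  case (less p)
  interpret A: overlap_ifs \<rho> m n k a by fact
  interpret B: overlap_ifs \<rho> m n k b by fact
  show ?case
  proof (cases p)
    case (Suc p')
    have "(\<Sum>l\<in>{1..n}. card (overlap_indices \<rho> m k a l) *
        (if k l \<le> Suc p' then card (cell_origins \<rho> m a (Suc p' - k l)) else 0))
      = (\<Sum>l\<in>{1..n}. card (overlap_indices \<rho> m k b l) *
        (if k l \<le> Suc p' then card (cell_origins \<rho> m b (Suc p' - k l)) else 0))"
    proof (rule sum.cong[OF refl])
      fix l assume l: "l \<in> {1..n}"
      have "Suc p' - k l < p" using A.k_pos[OF l] Suc by simp
      then show "card (overlap_indices \<rho> m k a l) *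
          (if k l \<le> Suc p' then card (cell_origins \<rho> m a (Suc p' - k l)) else 0)
        = card (overlap_indices \<rho> m k b l) *
          (if k l \<le> Suc p' then card (cell_origins \<rho> m b (Suc p' - k l)) else 0)"
        using same l less.IH by simp
    qed
    moreover have "card (cell_origins \<rho> m a p') = card (cell_origins \<rho> m b p')"
      using less.IH[of p'] Suc by simp
    note eqs = this calculation
    show ?thesis
      using A.card_D_recursion[of p'] B.card_D_recursion[of p'] unfolding Suc eqs by linarith
  qed simp
qed

theorem corollary1p2:
  fixes \<rho> :: real and m n :: nat and k :: "nat \<Rightarrow> nat" and a b :: "nat \<Rightarrow> real"
  assumes "0 < \<rho>" and "\<rho> < 1"
    and "m \<ge> 3"
    and "n \<ge> 1"
    and "\<forall>i\<in>{1..n}. \<forall>j\<in>{1..n}. i < j \<longrightarrow> k j < k i"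
    and "\<forall>l\<in>{1..n}. k l \<ge> 2"
    and "a \<in> overlap_class \<rho> m n k"
    and "b \<in> overlap_class \<rho> m n k"
    and "\<forall>l\<in>{1..n}. card (overlap_indices \<rho> m k a l) = card (overlap_indices \<rho> m k b l)"
  shows "hausdorff_dim (self_similar_set \<rho> m a) = hausdorff_dim (self_similar_set \<rho> m b)"
proof -
  have "inj_on k {1..n}"
    using assms(5) by (intro linorder_inj_onI) (metis less_irrefl, auto)
  moreover have "1 \<le> k l" if "l \<in> {1..n}" for l using assms(6) that by fastforce
  ultimately have ab: "overlap_ifs \<rho> m n k a" "overlap_ifs \<rho> m n k b"
    unfolding overlap_ifs_def using assms(1-3,7,8) by auto
  interpret A: overlap_ifs \<rho> m n k a by (rule ab)
  interpret B: overlap_ifs \<rho> m n k b by (rule ab)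
  obtain CA where CA: "\<And>p y. card {t \<in> A.D p. y \<le> t \<and> t \<le> y + \<rho> ^ p} \<le> CA"
    using A.ex_window_bound by blast
  obtain CB where CB: "\<And>p y. card {t \<in> B.D p. y \<le> t \<and> t \<le> y + \<rho> ^ p} \<le> CB"
    using B.ex_window_bound by blast
  have "hausdorff_measure s A.attractor = 0 \<longleftrightarrow> hausdorff_measure s B.attractor = 0"
    if "0 \<le> s" for s
    unfolding A.measure_attractor_eq_0_iff[OF CA that] B.measure_attractor_eq_0_iff[OF CB that]
      card_cell_origins_eq[OF ab assms(9)] by (rule refl)
  then show ?thesis
    unfolding hausdorff_dim_def A.self_similar_set_eq B.self_similar_set_eq by (metis (lifting))
qed

end
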